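(* There is a countably compact Hausdorff topological space of cardinality $\aleph_1$ which is not weakly Whyburn.
   Context: A space is countably compact if every countable open cover has a finite subcover. Given a space $X$, a set $B \subset X$ is an almost closed set converging to $x$ if $\overline{B} \setminus B = \{x\}$. A space $X$ is weakly Whyburn if for every non-closed set $A \subset X$ there is an almost closed set $B \subset A$ which converges to a point outside of $A$; equivalently, for every non-closed $A \subset X$ there is $B \subset A$ such that $\overline{B} \setminus A$ is a singleton. *)

theory Defs
  imports "HOL-Analysis.Analysis"
begin

unbundle cardinal_syntax

definition countably_compact_space :: "'a topology \<Rightarrow> bool" where
  "countably_compact_space X \<longleftrightarrow>
     (\<forall>\<U>. countable \<U> \<and> (\<forall>U \<in> \<U>. openin X U) \<and> topspace X \<subseteq> \<Union>\<U>
          \<longrightarrow> (\<exists>\<F>. finite \<F> \<and> \<F> \<subseteq> \<U> \<and> topspace X \<subseteq> \<Union>\<F>))"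

definition almost_closed_converging_to :: "'a topology \<Rightarrow> 'a set \<Rightarrow> 'a \<Rightarrow> bool" where
  "almost_closed_converging_to X B x \<longleftrightarrow>
     B \<subseteq> topspace X \<and> (X closure_of B) - B = {x}"

definition weakly_Whyburn_space :: "'a topology \<Rightarrow> bool" where
  "weakly_Whyburn_space X \<longleftrightarrow>
     (\<forall>A. A \<subseteq> topspace X \<and> \<not> closedin X A
          \<longrightarrow> (\<exists>B x. B \<subseteq> A \<and> x \<notin> A \<and> almost_closed_converging_to X B x))"

text \<open>The cardinal aleph-one is the cardinal successor of \<open>natLeq\<close>.  As HOL cannot quantify
  existentially over types, a space of this cardinality is taken to live on a subset of the type
  \<^typ>\<open>nat set\<close>; by the next lemma this is no restriction up to homeomorphism.\<close>

lemma aleph1_space_homeomorphic_nat_set_topology: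
  fixes X :: "'a topology"
  assumes "|topspace X| =o cardSuc natLeq"
  shows "\<exists>Y :: nat set topology. X homeomorphic_space Y"
proof -
  have "natLeq <o |UNIV :: nat set set|"
    by (metis Pow_UNIV card_of_Pow card_of_nat ordIso_ordLess_trans ordIso_symmetric)
  then have "cardSuc natLeq \<le>o |UNIV :: nat set set|"
    by (intro cardSuc_least natLeq_Card_order card_of_Card_order)
  then have "|topspace X| \<le>o |UNIV :: nat set set|"
    using assms ordIso_ordLeq_trans by blast
  then obtain f :: "'a \<Rightarrow> nat set" where f: "inj_on f (topspace X)"
    by (auto simp flip: card_of_ordLeq)
  define g where "g = inv_into (topspace X) f"
  define Y where "Y = pullback_topology (f ` topspace X) g X"
  have gf: "g (f x) = x" if "x \<in> topspace X" for x
    using f that by (simp add: g_def)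
  have tY: "topspace Y = f ` topspace X"
    using gf by (auto simp: Y_def topspace_pullback_topology)
  have "continuous_map Y X g"
    unfolding Y_def using continuous_map_pullback[OF continuous_map_id[of X], of "f ` topspace X" g] by simp
  moreover have "continuous_map X Y f"
    unfolding Y_def
    using gf by (intro continuous_map_pullback') (auto intro: continuous_map_eq[OF continuous_map_id])
  ultimately have "homeomorphic_maps X Y f g"
    using gf tY by (auto simp: homeomorphic_maps_def)
  then show ?thesis
    by (auto simp: homeomorphic_space_def)
qed

end

theory Submission
  imports Defs "HOL-Library.Countable_Set_Type"
begin

text \<open>Let \<open>W\<close> be the first uncountable ordinal, turned into a tree by a function \<open>parent\<close> all of
  whose fibres are unbounded. A set \<open>B\<close> is small at a node \<open>s\<close> if, after cutting off countably many
  children of every node, every infinite path from \<open>s\<close> meets \<open>B\<close> only finitely often. The space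
  consists of a copy \<open>A\<close> of the first uncountable ordinal with the isolated points \<open>Iso w\<close>, and of a
  second copy of it with points \<open>Far w\<close>, where a neighbourhood of \<open>Far s\<close> has to contain all \<open>Iso w\<close> except for
  a set of \<open>w\<close> that is small at \<open>s\<close>. Increasing sequences in either copy converge, hence countable
  compactness. A set that is not small at \<open>s\<close> is not small at some child of \<open>s\<close> either, so a subset
  of \<open>A\<close> never acquires exactly one new limit point. For the Hausdorff property, countably
  many nodes, all \<open>\<le> r\<close>, are separated simultaneously by sending each \<open>y\<close> to its first
  iterated parent that is \<open>\<le> r\<close>.\<close>

section \<open>Topological preliminaries\<close>

text \<open>Given an enumerated cover without finite subcover, choose \<open>x n\<close> outside
  \<open>u 0\<close>, ..., \<open>u n\<close>. Each set of the cover then contains only finitely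
  many of these points, so \<open>range x\<close> has no accumulation point.\<close>

lemma countably_compact_spaceI:
  assumes "\<And>Y. Y \<subseteq> topspace X \<Longrightarrow> infinite Y \<Longrightarrow>
             \<exists>p \<in> topspace X. \<forall>U. openin X U \<and> p \<in> U \<longrightarrow> infinite (U \<inter> Y)"
  shows "countably_compact_space X"
  unfolding countably_compact_space_def
proof (intro allI impI, elim conjE, rule ccontr)
  fix \<U> assume \<U>: "countable \<U>" "\<forall>U\<in>\<U>. openin X U" "topspace X \<subseteq> \<Union>\<U>"
    and nofin: "\<nexists>\<F>. finite \<F> \<and> \<F> \<subseteq> \<U> \<and> topspace X \<subseteq> \<Union>\<F>"
  then have "\<U> \<noteq> {}" by blast
  define u where "u = from_nat_into \<U>"
  have u: "range u = \<U>"
    using \<open>\<U> \<noteq> {}\<close> \<U>(1) by (simp add: u_def)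
  have "\<exists>x. x \<in> topspace X \<and> (\<forall>i\<le>n. x \<notin> u i)" for n
  proof (rule ccontr)
    assume "\<nexists>x. x \<in> topspace X \<and> (\<forall>i\<le>n. x \<notin> u i)"
    then have "topspace X \<subseteq> \<Union>(u ` {..n})" by auto
    moreover have "finite (u ` {..n})" "u ` {..n} \<subseteq> \<U>" using u by auto
    ultimately show False using nofin by blast
  qed
  then obtain x where x: "\<And>n. x n \<in> topspace X" "\<And>n i. i \<le> n \<Longrightarrow> x n \<notin> u i"
    by metis
  have fin: "finite (u k \<inter> range x)" for k
  proof (rule finite_subset)
    show "u k \<inter> range x \<subseteq> x ` {..<k}"
      using x(2) by (auto simp: image_iff) (metis lessThan_iff not_le)
  qed simp
  have "infinite (range x)"
  proof
    assume f: "finite (range x)"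
    have "\<forall>p \<in> range x. \<exists>k. p \<in> u k"
      using x(1) \<U>(3) u by blast
    then obtain k where k: "\<And>p. p \<in> range x \<Longrightarrow> p \<in> u (k p)" by metis
    \<comment> \<open>Finitely many points would need only indices up to some \<open>m\<close>, but
      \<open>x m\<close> avoids every \<open>u i\<close> with \<open>i \<le> m\<close>.\<close>
    have "k (x (Max (k ` range x))) \<le> Max (k ` range x)"
      using f by (intro Max_ge) auto
    then show False using x(2) k by blast
  qed
  then obtain p where p: "p \<in> topspace X" "\<And>U. openin X U \<Longrightarrow> p \<in> U \<Longrightarrow> infinite (U \<inter> range x)"
    using assms[of "range x"] x(1) by blast
  obtain k where "p \<in> u k" using p(1) \<U>(3) u by blast
  moreover have "openin X (u k)" using u \<U>(2) by blast
  ultimately show False using p(2) fin by blast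
qed

lemma countably_compact_space_continuous_map_image:
  assumes f: "continuous_map X Y f" "f ` topspace X = topspace Y" and "countably_compact_space X"
  shows "countably_compact_space Y"
  unfolding countably_compact_space_def
proof (intro allI impI, elim conjE)
  fix \<U> assume \<U>: "countable \<U>" "\<forall>U\<in>\<U>. openin Y U" "topspace Y \<subseteq> \<Union>\<U>"
  define g where "g U = {x \<in> topspace X. f x \<in> U}" for U
  have "countable (g ` \<U>)" "\<forall>V\<in>g ` \<U>. openin X V"
    using \<U> f by (auto simp: g_def openin_continuous_map_preimage)
  moreover have "topspace X \<subseteq> \<Union>(g ` \<U>)"
  proof
    fix x assume x: "x \<in> topspace X"
    then obtain U where "U \<in> \<U>" "f x \<in> U" using \<U>(3) f(2) by blast
    then show "x \<in> \<Union>(g ` \<U>)" using x by (auto simp: g_def)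
  qed
  ultimately have "\<exists>\<F>. finite \<F> \<and> \<F> \<subseteq> g ` \<U> \<and> topspace X \<subseteq> \<Union>\<F>"
    using assms(3) by (simp add: countably_compact_space_def)
  then obtain \<G> where \<G>: "\<G> \<subseteq> \<U>" "finite \<G>" "topspace X \<subseteq> \<Union>(g ` \<G>)"
    by (auto dest: finite_subset_image)
  have "topspace Y \<subseteq> \<Union>\<G>"
  proof
    fix y assume "y \<in> topspace Y"
    then obtain x where "x \<in> topspace X" "y = f x" using f(2) by blast
    then show "y \<in> \<Union>\<G>" using \<G>(3) by (auto simp: g_def)
  qed
  with \<G> show "\<exists>\<F>. finite \<F> \<and> \<F> \<subseteq> \<U> \<and> topspace Y \<subseteq> \<Union>\<F>" by blast
qed

text \<open>Used contrapositively, to carry the counterexample over to a copy on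
  \<open>nat set\<close>.\<close>

lemma weakly_Whyburn_space_homeomorphic_map:
  assumes f: "homeomorphic_map X Y f" and Y: "weakly_Whyburn_space Y"
  shows "weakly_Whyburn_space X"
  unfolding weakly_Whyburn_space_def
proof (intro allI impI, elim conjE)
  fix A assume A: "A \<subseteq> topspace X" "\<not> closedin X A"
  have inj: "inj_on f (topspace X)" and im: "f ` topspace X = topspace Y"
    using f by (auto simp: homeomorphic_eq_everything_map)
  have fA: "f ` A \<subseteq> topspace Y" using A(1) im by blast
  moreover have "\<not> closedin Y (f ` A)"
    using A(2) homeomorphic_map_closedness[OF f A(1)] by simp
  ultimately obtain B' y where B': "B' \<subseteq> f ` A" "y \<notin> f ` A" "Y closure_of B' - B' = {y}"
    using Y unfolding weakly_Whyburn_space_def almost_closed_converging_to_def by meson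
  obtain B where B: "B \<subseteq> A" "B' = f ` B"
    using B'(1) by (rule subset_imageE)
  have BX: "B \<subseteq> topspace X" using B(1) A(1) by (rule subset_trans)
  have cl: "X closure_of B \<subseteq> topspace X" by (rule closure_of_subset_topspace)
  have "f ` (X closure_of B - B) = f ` (X closure_of B) - f ` B"
    using inj cl BX by (intro inj_on_image_set_diff) blast+
  also have "\<dots> = {y}"
    using B' B(2) homeomorphic_map_closure_of[OF f BX] by simp
  finally have im1: "f ` (X closure_of B - B) = {y}" .
  then obtain x where x: "x \<in> X closure_of B - B" "f x = y" by blast
  have "x' = x" if x': "x' \<in> X closure_of B - B" for x'
  proof (rule inj_onD[OF inj])
    show "f x' = f x" using im1 x' x(2) by blast
  qed (use x' x(1) cl in blast)+
  then have "X closure_of B - B = {x}" using x(1) by blast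
  moreover have "x \<notin> A" using x(2) B'(2) by blast
  ultimately show "\<exists>B x. B \<subseteq> A \<and> x \<notin> A \<and> almost_closed_converging_to X B x"
    using B(1) BX unfolding almost_closed_converging_to_def by blast
qed

section \<open>The space over a tree of height omega on the countable ordinals\<close>

text \<open>The first two assumptions fix the order type of \<open>'w\<close> as the first
  uncountable ordinal. Nothing forces \<open>parent x < x\<close>, so \<open>path\<close> and
  \<open>ancestor\<close> demand the increase along edges themselves.\<close>

locale omega1_tree =
  fixes parent :: "'w::wellorder \<Rightarrow> 'w"
  assumes countable_atMost: "countable {..w::'w}"
    and uncountable_UNIV: "uncountable (UNIV :: 'w set)"
    and unbounded_fibre: "\<exists>x>b. parent x = s"
begin

section \<open>Suprema of countable sets and of increasing sequences\<close>

text \<open>Regularity of the first uncountable ordinal: countably many countable initial segments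
  cannot cover it.\<close>

lemma countable_bounded:
  assumes "countable (A :: 'w set)"
  obtains b where "\<And>a. a \<in> A \<Longrightarrow> a < b"
proof -
  have "countable (\<Union>a\<in>A. {..a})" using assms countable_atMost by blast
  then obtain b where "b \<notin> (\<Union>a\<in>A. {..a})"
    using uncountable_UNIV by (metis UNIV_eq_I)
  then show thesis using that[of b] by force
qed

definition converges_up :: "(nat \<Rightarrow> 'w) \<Rightarrow> 'w \<Rightarrow> bool" where
  "converges_up f w \<longleftrightarrow> strict_mono f \<and> (\<forall>n. f n < w) \<and> (\<forall>v<w. \<exists>n. v < f n)"

text \<open>The range is countable, hence bounded; its least strict upper bound is the
  limit.\<close>

lemma ex_converges_up:
  assumes "strict_mono (f :: nat \<Rightarrow> 'w)"
  shows "\<exists>w. converges_up f w"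
proof -
  have "countable (range f)" by simp
  then obtain b where "\<And>a. a \<in> range f \<Longrightarrow> a < b" using countable_bounded by blast
  then have b: "\<forall>n. f n < b" by blast
  define w where "w = (LEAST w. \<forall>n. f n < w)"
  have w: "\<forall>n. f n < w" unfolding w_def using b by (rule LeastI)
  have "\<exists>n. v < f n" if "v < w" for v
  proof -
    have "\<not> (\<forall>n. f n < v)"
      using that unfolding w_def by (rule not_less_Least)
    then obtain n where "\<not> f n < v" by blast
    then have "v < f (Suc n)" using assms by (metis lessI not_less order_le_less_trans strict_mono_less)
    then show ?thesis ..
  qed
  then show ?thesis using w assms unfolding converges_up_def by blast
qed

lemma converges_up_eventually:
  assumes "converges_up f w" "v < w"
  shows "\<exists>m. \<forall>n\<ge>m. v < f n"
  using assms unfolding converges_up_def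
  by (metis order_less_le_trans strict_mono_less_eq)

lemma converges_up_less: "converges_up f w \<Longrightarrow> w \<le> x \<Longrightarrow> f n < x"
  unfolding converges_up_def by (blast intro: less_le_trans)

section \<open>Paths and the ideal of sets small at a node\<close>

text \<open>Cutting off countably many children of \<open>y\<close> is coded by the bound
  \<open>N y\<close>: countable sets are bounded, and initial segments are countable.\<close>

definition path :: "('w \<Rightarrow> 'w) \<Rightarrow> 'w \<Rightarrow> (nat \<Rightarrow> 'w) \<Rightarrow> bool" where
  "path N s f \<longleftrightarrow> f 0 = s \<and>
     (\<forall>n. parent (f (Suc n)) = f n \<and> f n < f (Suc n) \<and> N (f n) < f (Suc n))"

text \<open>For fixed \<open>s\<close> these sets form a proper ideal containing all countable sets.
  The \<open>Iso\<close> traces of neighbourhoods of \<open>Far s\<close> will lie in the dual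
  filter.\<close>

definition small :: "'w \<Rightarrow> 'w set \<Rightarrow> bool" where
  "small s B \<longleftrightarrow> (\<exists>N. \<forall>f. path N s f \<longrightarrow> finite {n. f n \<in> B})"

lemma path_mono: "path N s f \<Longrightarrow> (\<And>y. M y \<le> N y) \<Longrightarrow> path M s f"
  unfolding path_def by (auto intro: order_le_less_trans)

lemma path_strict_mono: "path N s f \<Longrightarrow> strict_mono f"
  by (simp add: path_def strict_mono_Suc_iff)

lemma ex_path: "\<exists>f. path N s f"
proof -
  have "\<exists>x. parent x = y \<and> y < x \<and> N y < x" for y
    using unbounded_fibre[of "max y (N y)" y] by auto
  then obtain g where g: "\<And>y. parent (g y) = y \<and> y < g y \<and> N y < g y" by metis
  then have "path N s (\<lambda>n. (g ^^ n) s)" by (simp add: path_def)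
  then show ?thesis by blast
qed

lemma not_small_UNIV: "\<not> small s UNIV"
  using ex_path by (auto simp: small_def)

lemma small_mono: "small s B \<Longrightarrow> C \<subseteq> B \<Longrightarrow> small s C"
proof -
  assume "small s B" and C: "C \<subseteq> B"
  then obtain N where N: "\<And>f. path N s f \<Longrightarrow> finite {n. f n \<in> B}"
    unfolding small_def by blast
  have "finite {n. f n \<in> C}" if "path N s f" for f
    by (rule finite_subset[OF _ N[OF that]]) (use C in blast)
  then show "small s C" unfolding small_def by blast
qed

lemma small_Un:
  assumes "small s B" "small s C"
  shows "small s (B \<union> C)"
proof -
  obtain M N where MN: "\<And>f. path M s f \<Longrightarrow> finite {n. f n \<in> B}"
      "\<And>f. path N s f \<Longrightarrow> finite {n. f n \<in> C}"
    using assms unfolding small_def by blast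
  have "finite {n. f n \<in> B \<union> C}" if "path (\<lambda>y. max (M y) (N y)) s f" for f
  proof -
    have "finite ({n. f n \<in> B} \<union> {n. f n \<in> C})"
      using MN path_mono[OF that] by auto
    then show ?thesis by (simp add: Collect_disj_eq)
  qed
  then show ?thesis unfolding small_def by blast
qed

text \<open>With a constant bound above \<open>B\<close>, a path can meet \<open>B\<close> only at
  its starting node.\<close>

lemma small_countable:
  assumes "countable B"
  shows "small s B"
proof -
  obtain b where b: "\<And>a. a \<in> B \<Longrightarrow> a < b" using countable_bounded[OF assms] by blast
  have "finite {n. f n \<in> B}" if "path (\<lambda>_. b) s f" for f
  proof (rule finite_subset)
    show "{n. f n \<in> B} \<subseteq> {0}"
      using that b unfolding path_def by (auto, metis less_asym not0_implies_Suc)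
  qed simp
  then show ?thesis unfolding small_def by blast
qed

text \<open>A single bound \<open>N\<close> beats the witnesses \<open>M x\<close> of all children \<open>x\<close> at once: only countably
  many \<open>x\<close> lie below a given \<open>y\<close>, and paths are increasing.\<close>

lemma small_if_small_children:
  assumes "\<And>x. c < x \<Longrightarrow> parent x = s \<Longrightarrow> small x B"
  shows "small s B"
proof -
  obtain M where M: "\<And>x f. c < x \<Longrightarrow> parent x = s \<Longrightarrow> path (M x) x f \<Longrightarrow> finite {n. f n \<in> B}"
    using assms unfolding small_def by metis
  \<comment> \<open>Requiring \<open>c \<le> b\<close> makes the first step of a path lead to a
    child beyond \<open>c\<close>, where the assumption applies.\<close>
  have "\<exists>b. c \<le> b \<and> (\<forall>x\<le>y. M x y \<le> b)" for y
  proof -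
    have "countable (insert c ((\<lambda>x. M x y) ` {..y}))" using countable_atMost by blast
    then obtain b where b: "\<And>a. a \<in> insert c ((\<lambda>x. M x y) ` {..y}) \<Longrightarrow> a < b"
      using countable_bounded by blast
    show ?thesis
      using b by (intro exI[of _ b]) (auto intro: less_imp_le)
  qed
  then obtain N where N: "\<And>y. c \<le> N y" "\<And>x y. x \<le> y \<Longrightarrow> M x y \<le> N y" by metis
  have "finite {n. f n \<in> B}" if f: "path N s f" for f
  proof -
    have "path (M (f 1)) (f 1) (\<lambda>n. f (Suc n))"
      unfolding path_def
    proof (intro conjI allI)
      fix n
      have "f 1 \<le> f (Suc n)" using path_strict_mono[OF f] by (simp add: strict_mono_less_eq)
      then have "M (f 1) (f (Suc n)) \<le> N (f (Suc n))" by (rule N)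
      also have "\<dots> < f (Suc (Suc n))" using f by (simp add: path_def)
      finally show "M (f 1) (f (Suc n)) < f (Suc (Suc n))" .
    qed (use f in \<open>auto simp: path_def\<close>)
    moreover have "c < f 1" "parent (f 1) = s"
      using f N(1)[of s] unfolding path_def by (auto, metis order_le_less_trans)
    ultimately have "finite {n. f (Suc n) \<in> B}" using M by blast
    then have "finite (insert 0 (Suc ` {n. f (Suc n) \<in> B}))" by blast
    moreover have "{n. f n \<in> B} \<subseteq> insert 0 (Suc ` {n. f (Suc n) \<in> B})"
      by (auto simp: image_iff) (metis not0_implies_Suc)
    ultimately show ?thesis by (rule rev_finite_subset)
  qed
  then show ?thesis unfolding small_def by blast
qed

section \<open>Descending to the first ancestor below a bound\<close>

text \<open>The guard \<open>parent y < y\<close> ensures termination. Where it stops the descent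
  too early the value exceeds \<open>r\<close>, and such \<open>y\<close> fall outside every set
  \<open>K \<subseteq> {..r}\<close> used for separation.\<close>

function ancestor :: "'w \<Rightarrow> 'w \<Rightarrow> 'w" where
  "ancestor r y = (if r < y \<and> parent y < y then ancestor r (parent y) else y)"
  by pat_completeness auto
termination
  by (relation "inv_image {(x, y). x < y} snd") (rule wf_inv_image, rule wf, simp)

declare ancestor.simps [simp del]

text \<open>Under the constant bound \<open>r\<close> every node after the start lies above
  \<open>r\<close>, so the descent retraces the path and stops exactly at \<open>s\<close>.\<close>

lemma ancestor_path:
  assumes "path (\<lambda>_. r) s f" "s \<le> r"
  shows "ancestor r (f n) = s"
proof (induction n)
  case 0
  then show ?case using assms by (subst ancestor.simps) (simp add: path_def leD)
next
  case (Suc n)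
  then show ?case using assms(1) by (subst ancestor.simps) (simp add: path_def)
qed

text \<open>Paths from \<open>s\<close> with constant bound \<open>r\<close> miss the set
  altogether. The same bound serves all \<open>s \<le> r\<close> at once.\<close>

lemma small_ancestor:
  assumes "s \<le> r" "s \<in> K"
  shows "small s {y. ancestor r y \<notin> K}"
proof -
  have "{n. f n \<in> {y. ancestor r y \<notin> K}} = {}" if "path (\<lambda>_. r) s f" for f
    using ancestor_path[OF that assms(1)] assms(2) by auto
  then show ?thesis unfolding small_def by (metis finite.emptyI)
qed

end

text \<open>\<open>Iso\<close> and \<open>Mid\<close> points together form the copy \<open>A\<close>; its topology, like that of the \<open>Far\<close>
  points, is given by the limits of increasing sequences, as limits in the first uncountable
  ordinal have countable cofinality.\<close>

datatype 'w point = Iso 'w | Mid 'w | Far 'w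

context omega1_tree
begin

section \<open>The topology\<close>

text \<open>The first clause is the order topology on \<open>A\<close> when \<open>Iso w\<close> is
  placed directly after \<open>Mid w\<close>: both \<open>Iso (f n)\<close> and
  \<open>Mid (f n)\<close> then increase to \<open>Mid w\<close>.\<close>

definition is_open :: "'w point set \<Rightarrow> bool" where
  "is_open U \<longleftrightarrow>
     (\<forall>f w. converges_up f w \<and> Mid w \<in> U \<longrightarrow> (\<exists>m. \<forall>n\<ge>m. Iso (f n) \<in> U \<and> Mid (f n) \<in> U)) \<and>
     (\<forall>f w. converges_up f w \<and> Far w \<in> U \<longrightarrow> (\<exists>m. \<forall>n\<ge>m. Far (f n) \<in> U)) \<and>
     (\<forall>s. Far s \<in> U \<longrightarrow> small s {x. Iso x \<notin> U})"

lemma is_openI: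
  assumes "\<And>f w. converges_up f w \<Longrightarrow> Mid w \<in> U \<Longrightarrow> \<exists>m. \<forall>n\<ge>m. Iso (f n) \<in> U \<and> Mid (f n) \<in> U"
    and "\<And>f w. converges_up f w \<Longrightarrow> Far w \<in> U \<Longrightarrow> \<exists>m. \<forall>n\<ge>m. Far (f n) \<in> U"
    and "\<And>s. Far s \<in> U \<Longrightarrow> small s {x. Iso x \<notin> U}"
  shows "is_open U"
  using assms unfolding is_open_def by blast

lemma is_open_MidD:
  "is_open U \<Longrightarrow> converges_up f w \<Longrightarrow> Mid w \<in> U \<Longrightarrow> \<exists>m. \<forall>n\<ge>m. Iso (f n) \<in> U \<and> Mid (f n) \<in> U"
  unfolding is_open_def by blast

lemma is_open_FarD:
  "is_open U \<Longrightarrow> converges_up f w \<Longrightarrow> Far w \<in> U \<Longrightarrow> \<exists>m. \<forall>n\<ge>m. Far (f n) \<in> U"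
  unfolding is_open_def by blast

lemma is_open_smallD: "is_open U \<Longrightarrow> Far s \<in> U \<Longrightarrow> small s {x. Iso x \<notin> U}"
  unfolding is_open_def by blast

lemma istopology_is_open: "istopology is_open"
  unfolding istopology_def
proof (intro conjI allI impI)
  fix U V assume UV: "is_open U" "is_open V"
  show "is_open (U \<inter> V)"
  proof (rule is_openI)
    fix f w assume f: "converges_up f w" and w: "Mid w \<in> U \<inter> V"
    obtain m m' where "\<forall>n\<ge>m. Iso (f n) \<in> U \<and> Mid (f n) \<in> U" "\<forall>n\<ge>m'. Iso (f n) \<in> V \<and> Mid (f n) \<in> V"
      using is_open_MidD[OF _ f] UV w by blast
    then show "\<exists>m. \<forall>n\<ge>m. Iso (f n) \<in> U \<inter> V \<and> Mid (f n) \<in> U \<inter> V"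
      by (intro exI[of _ "max m m'"]) auto
  next
    fix f w assume f: "converges_up f w" and w: "Far w \<in> U \<inter> V"
    obtain m m' where "\<forall>n\<ge>m. Far (f n) \<in> U" "\<forall>n\<ge>m'. Far (f n) \<in> V"
      using is_open_FarD[OF _ f] UV w by blast
    then show "\<exists>m. \<forall>n\<ge>m. Far (f n) \<in> U \<inter> V"
      by (intro exI[of _ "max m m'"]) auto
  next
    fix s assume "Far s \<in> U \<inter> V"
    then have "small s ({x. Iso x \<notin> U} \<union> {x. Iso x \<notin> V})"
      using UV by (intro small_Un is_open_smallD) auto
    then show "small s {x. Iso x \<notin> U \<inter> V}" by (rule small_mono) blast
  qed
next
  fix \<K> assume \<K>: "\<forall>K\<in>\<K>. is_open K"
  show "is_open (\<Union>\<K>)"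
  proof (rule is_openI)
    fix f w assume "converges_up f w" "Mid w \<in> \<Union>\<K>"
    then show "\<exists>m. \<forall>n\<ge>m. Iso (f n) \<in> \<Union>\<K> \<and> Mid (f n) \<in> \<Union>\<K>"
      using \<K> is_open_MidD by (meson UnionE UnionI)
  next
    fix f w assume "converges_up f w" "Far w \<in> \<Union>\<K>"
    then show "\<exists>m. \<forall>n\<ge>m. Far (f n) \<in> \<Union>\<K>"
      using \<K> is_open_FarD by (meson UnionE UnionI)
  next
    fix s assume "Far s \<in> \<Union>\<K>"
    then obtain K where "K \<in> \<K>" "Far s \<in> K" by blast
    then have "small s {x. Iso x \<notin> K}" using \<K> is_open_smallD by blast
    then show "small s {x. Iso x \<notin> \<Union>\<K>}"
      by (rule small_mono) (use \<open>K \<in> \<K>\<close> in blast)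
  qed
qed

definition space :: "'w point topology" where
  "space = topology is_open"

lemma openin_space [simp]: "openin space U \<longleftrightarrow> is_open U"
  by (simp add: space_def istopology_is_open topology_inverse')

lemma topspace_space [simp]: "topspace space = UNIV"
proof -
  have "is_open UNIV"
    by (rule is_openI) (auto simp: small_countable)
  then show ?thesis by (metis UNIV_I openin_space openin_subset subset_antisym subset_UNIV)
qed

section \<open>Countable compactness\<close>

text \<open>The first omega elements of an infinite set of ordinals, listed in order, form such a
  sequence.\<close>

lemma ex_increasing_sequence:
  assumes "infinite (Y :: 'w set)"
  obtains f w where "converges_up f w" "range f \<subseteq> Y"
proof -
  have "strict_mono (enumerate Y)"
    using assms enumerate_step by (simp add: strict_mono_Suc_iff)
  then show thesis
    using ex_converges_up that assms enumerate_in_set by (metis image_subsetI)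
qed

lemma infinite_tail:
  assumes f: "converges_up f w" and "\<forall>n\<ge>m. c (f n) \<in> U \<inter> Y" and c: "inj c"
  shows "infinite (U \<inter> Y)"
proof -
  have "inj (c \<circ> f)"
    using f c by (auto simp: converges_up_def inj_compose strict_mono_imp_inj_on)
  then have "infinite ((c \<circ> f) ` {m..})"
    by (metis finite_imageD infinite_Ici inj_on_subset subset_UNIV)
  moreover have "(c \<circ> f) ` {m..} \<subseteq> U \<inter> Y" using assms(2) by auto
  ultimately show ?thesis using finite_subset by blast
qed

text \<open>Some constructor occurs infinitely often in \<open>Y\<close>. If \<open>w\<close> is the
  limit of an increasing sequence of the corresponding indices, \<open>Mid w\<close> is an
  accumulation point for \<open>Iso\<close> and \<open>Mid\<close>, and \<open>Far w\<close> for
  \<open>Far\<close>.\<close>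

lemma countably_compact_space: "countably_compact_space space"
proof (rule countably_compact_spaceI)
  fix Y :: "'w point set" assume "infinite Y"
  moreover have "Y = Iso ` (Iso -` Y) \<union> Mid ` (Mid -` Y) \<union> Far ` (Far -` Y)"
  proof -
    have "x \<in> Iso ` (Iso -` Y) \<union> Mid ` (Mid -` Y) \<union> Far ` (Far -` Y)" if "x \<in> Y" for x
      using that by (cases x) auto
    then show ?thesis by auto
  qed
  ultimately consider "infinite (Iso -` Y)" | "infinite (Mid -` Y)" | "infinite (Far -` Y)"
    by (metis finite_UnI finite_imageI)
  then show "\<exists>p\<in>topspace space. \<forall>U. openin space U \<and> p \<in> U \<longrightarrow> infinite (U \<inter> Y)"
  proof cases
    case 1
    then obtain f w where f: "converges_up f w" "range f \<subseteq> Iso -` Y"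
      using ex_increasing_sequence by blast
    have "infinite (U \<inter> Y)" if U: "is_open U" "Mid w \<in> U" for U
    proof -
      obtain m where m: "\<forall>n\<ge>m. Iso (f n) \<in> U \<and> Mid (f n) \<in> U"
        using is_open_MidD[OF U(1) f(1) U(2)] by blast
      have "\<forall>n\<ge>m. Iso (f n) \<in> U \<inter> Y" using m f(2) by auto
      then show ?thesis using infinite_tail[OF f(1)] by (meson injI point.inject(1))
    qed
    then show ?thesis by auto
  next
    case 2
    then obtain f w where f: "converges_up f w" "range f \<subseteq> Mid -` Y"
      using ex_increasing_sequence by blast
    have "infinite (U \<inter> Y)" if U: "is_open U" "Mid w \<in> U" for U
    proof -
      obtain m where m: "\<forall>n\<ge>m. Iso (f n) \<in> U \<and> Mid (f n) \<in> U"
        using is_open_MidD[OF U(1) f(1) U(2)] by blast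
      have "\<forall>n\<ge>m. Mid (f n) \<in> U \<inter> Y" using m f(2) by auto
      then show ?thesis using infinite_tail[OF f(1)] by (meson injI point.inject(2))
    qed
    then show ?thesis by auto
  next
    case 3
    then obtain f w where f: "converges_up f w" "range f \<subseteq> Far -` Y"
      using ex_increasing_sequence by blast
    have "infinite (U \<inter> Y)" if U: "is_open U" "Far w \<in> U" for U
    proof -
      obtain m where m: "\<forall>n\<ge>m. Far (f n) \<in> U"
        using is_open_FarD[OF U(1) f(1) U(2)] by blast
      have "\<forall>n\<ge>m. Far (f n) \<in> U \<inter> Y" using m f(2) by auto
      then show ?thesis using infinite_tail[OF f(1)] by (meson injI point.inject(3))
    qed
    then show ?thesis by auto
  qed
qed

section \<open>Separation of points\<close>

lemma is_open_initial: "is_open (Iso ` {..x} \<union> Mid ` {..x})"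
proof (rule is_openI)
  fix f w assume f: "converges_up f w" and w: "Mid w \<in> Iso ` {..x} \<union> Mid ` {..x}"
  have "f n \<le> x" for n
    using converges_up_less[OF f, of x n] w by auto
  then show "\<exists>m. \<forall>n\<ge>m. Iso (f n) \<in> Iso ` {..x} \<union> Mid ` {..x} \<and> Mid (f n) \<in> Iso ` {..x} \<union> Mid ` {..x}"
    by simp
qed auto

text \<open>This is the complement of the initial segment in \<open>is_open_initial\<close>. It
  omits only countably many \<open>Iso\<close> points, so the condition at every
  \<open>Far s\<close> holds.\<close>

lemma is_open_final: "is_open (Iso ` {x<..} \<union> Mid ` {x<..} \<union> range Far)"
proof (rule is_openI)
  fix f w assume "converges_up f w" "Mid w \<in> Iso ` {x<..} \<union> Mid ` {x<..} \<union> range Far"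
  then show "\<exists>m. \<forall>n\<ge>m. Iso (f n) \<in> Iso ` {x<..} \<union> Mid ` {x<..} \<union> range Far \<and>
      Mid (f n) \<in> Iso ` {x<..} \<union> Mid ` {x<..} \<union> range Far"
    using converges_up_eventually[of f w x] by (auto simp: image_iff)
next
  fix s
  show "small s {y. Iso y \<notin> Iso ` {x<..} \<union> Mid ` {x<..} \<union> range Far}"
    by (rule small_mono[OF small_countable[OF countable_atMost[of x]]]) (auto simp: not_less)
qed auto

lemma is_open_singleton: "is_open {Iso x}"
  by (rule is_openI) auto

lemma is_open_Compl_singleton: "is_open (- {Iso x})"
proof (rule is_openI)
  fix f w assume "converges_up f w" "Mid w \<in> - {Iso x}"
  then show "\<exists>m. \<forall>n\<ge>m. Iso (f n) \<in> - {Iso x} \<and> Mid (f n) \<in> - {Iso x}"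
  proof (cases "x < w")
    case True
    then obtain m where "\<forall>n\<ge>m. x < f n"
      using converges_up_eventually[OF \<open>converges_up f w\<close>] by blast
    then have "\<forall>n\<ge>m. f n \<noteq> x" by blast
    then show ?thesis by (intro exI[of _ m]) simp
  next
    case False
    then have "f n < x" for n
      using converges_up_less[OF \<open>converges_up f w\<close>, of x n] by (simp add: not_less)
    then have "f n \<noteq> x" for n by (simp add: less_imp_neq)
    then show ?thesis by simp
  qed
qed (auto simp: small_countable)

text \<open>Disjoint sets \<open>K\<close> have disjoint preimages under the single function
  \<open>ancestor r\<close>, so this turns a separation of ordinals up to \<open>r\<close> into one
  of \<open>Far\<close> points.\<close>

lemma is_open_Far_ancestor:
  assumes "\<And>f w. converges_up f w \<Longrightarrow> w \<in> K \<Longrightarrow> \<exists>m. \<forall>n\<ge>m. f n \<in> K" and "K \<subseteq> {..r}"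
  shows "is_open (Far ` K \<union> Iso ` {y. ancestor r y \<in> K})"
proof (rule is_openI)
  fix f w assume "converges_up f w" "Far w \<in> Far ` K \<union> Iso ` {y. ancestor r y \<in> K}"
  then show "\<exists>m. \<forall>n\<ge>m. Far (f n) \<in> Far ` K \<union> Iso ` {y. ancestor r y \<in> K}"
    using assms(1)[of f w] by (auto simp: image_iff)
next
  fix s assume "Far s \<in> Far ` K \<union> Iso ` {y. ancestor r y \<in> K}"
  then have "small s {y. ancestor r y \<notin> K}"
    using assms(2) by (intro small_ancestor) auto
  then show "small s {x. Iso x \<notin> Far ` K \<union> Iso ` {y. ancestor r y \<in> K}}"
    by (rule small_mono) auto
qed auto

text \<open>Split \<open>{..t}\<close> into the clopen pieces \<open>{..r}\<close> and
  \<open>{r<..t}\<close>, and use the same \<open>ancestor t\<close> for both.\<close>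

lemma separate_Far:
  assumes "r < t"
  shows "\<exists>U V. is_open U \<and> is_open V \<and> Far r \<in> U \<and> Far t \<in> V \<and> disjnt U V"
proof (intro exI conjI)
  show "is_open (Far ` {..r} \<union> Iso ` {y. ancestor t y \<in> {..r}})"
  proof (rule is_open_Far_ancestor)
    fix f w assume f: "converges_up f w" and w: "w \<in> {..r}"
    have "f n \<le> r" for n using converges_up_less[OF f, of r n] w by simp
    then show "\<exists>m. \<forall>n\<ge>m. f n \<in> {..r}" by simp
  qed (use assms in auto)
  show "is_open (Far ` {r<..t} \<union> Iso ` {y. ancestor t y \<in> {r<..t}})"
  proof (rule is_open_Far_ancestor)
    fix f w assume f: "converges_up f w" and w: "w \<in> {r<..t}"
    have "f n \<le> t" for n using converges_up_less[OF f, of t n] w by simp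
    moreover obtain m where "\<forall>n\<ge>m. r < f n"
      using converges_up_eventually[OF f, of r] w by auto
    ultimately show "\<exists>m. \<forall>n\<ge>m. f n \<in> {r<..t}" by auto
  qed auto
qed (use assms in \<open>auto simp: disjnt_def\<close>)

lemma separate_Mid:
  assumes "x < y"
  shows "\<exists>U V. is_open U \<and> is_open V \<and> Mid x \<in> U \<and> Mid y \<in> V \<and> disjnt U V"
  using assms is_open_initial[of x] is_open_final[of x]
  by (intro exI[of _ "Iso ` {..x} \<union> Mid ` {..x}"] exI[of _ "Iso ` {x<..} \<union> Mid ` {x<..} \<union> range Far"])
    (auto simp: disjnt_def)

lemma separate_Mid_Far: "\<exists>U V. is_open U \<and> is_open V \<and> Mid x \<in> U \<and> Far y \<in> V \<and> disjnt U V"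
  using is_open_initial[of x] is_open_final[of x]
  by (intro exI[of _ "Iso ` {..x} \<union> Mid ` {..x}"] exI[of _ "Iso ` {x<..} \<union> Mid ` {x<..} \<union> range Far"])
    (auto simp: disjnt_def)

lemma separate_Iso:
  assumes "q \<noteq> Iso x"
  shows "\<exists>U V. is_open U \<and> is_open V \<and> Iso x \<in> U \<and> q \<in> V \<and> disjnt U V"
  using assms is_open_singleton[of x] is_open_Compl_singleton[of x]
  by (intro exI[of _ "{Iso x}"] exI[of _ "- {Iso x}"]) (auto simp: disjnt_def)

lemma Hausdorff_space: "Hausdorff_space space"
  unfolding Hausdorff_space_def
proof (intro allI impI, elim conjE)
  fix p q :: "'w point" assume "p \<noteq> q"
  define sep where "sep a b \<longleftrightarrow> (\<exists>U V. is_open U \<and> is_open V \<and> a \<in> U \<and> b \<in> V \<and> disjnt U V)"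
    for a b :: "'w point"
  have sym: "sep a b \<Longrightarrow> sep b a" for a b unfolding sep_def by (metis disjnt_sym)
  note separate = separate_Far separate_Mid separate_Mid_Far separate_Iso
  have "sep p q"
    using \<open>p \<noteq> q\<close> separate[folded sep_def] separate[folded sep_def, THEN sym]
    by (cases p; cases q) (simp, metis neqE)+
  then show "\<exists>U V. openin space U \<and> openin space V \<and> p \<in> U \<and> q \<in> V \<and> disjnt U V"
    by (simp add: sep_def)
qed

section \<open>Limit points of subsets of \<open>A\<close>, and failure of the weak Whyburn
  property\<close>

lemma Far_in_closure:
  assumes "\<not> small s {w. Iso w \<in> B}"
  shows "Far s \<in> space closure_of B"
proof -
  have "\<exists>y\<in>B. y \<in> U" if U: "is_open U" "Far s \<in> U" for U
  proof (rule ccontr)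
    assume "\<not> (\<exists>y\<in>B. y \<in> U)"
    then have "{w. Iso w \<in> B} \<subseteq> {w. Iso w \<notin> U}" by blast
    then show False using is_open_smallD[OF U] small_mono assms by blast
  qed
  then show ?thesis by (auto simp: in_closure_of)
qed

lemma not_small_if_Far_in_closure:
  assumes "Far r \<in> space closure_of B" "B \<inter> range Far = {}"
  shows "\<exists>s\<le>r. \<not> small s {w. Iso w \<in> B}"
proof (rule ccontr)
  assume *: "\<not> (\<exists>s\<le>r. \<not> small s {w. Iso w \<in> B})"
  define U where "U = Far ` {..r} \<union> {Iso w | w. Iso w \<notin> B}"
  have "is_open U"
  proof (rule is_openI)
    fix s assume "Far s \<in> U"
    then have "small s {w. Iso w \<in> B}" using * by (auto simp: U_def)
    then show "small s {x. Iso x \<notin> U}" by (rule small_mono) (auto simp: U_def)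
  next
    fix f w assume f: "converges_up f w" and w: "Far w \<in> U"
    have "f n \<le> r" for n using converges_up_less[OF f, of r n] w by (auto simp: U_def)
    then show "\<exists>m. \<forall>n\<ge>m. Far (f n) \<in> U" by (simp add: U_def)
  qed (auto simp: U_def)
  moreover have "Far r \<in> U" by (simp add: U_def)
  ultimately obtain y where "y \<in> B" "y \<in> U"
    using assms(1) by (auto simp: in_closure_of)
  then show False using assms(2) by (auto simp: U_def)
qed

lemma not_weakly_Whyburn_space: "\<not> weakly_Whyburn_space space"
proof
  assume W: "weakly_Whyburn_space space"
  define A :: "'w point set" where "A = - range Far"
  have "\<not> is_open (range Far)"
  proof
    assume "is_open (range Far)"
    then have "small s {x. Iso x \<notin> range Far}" for s by (rule is_open_smallD) simp
    moreover have "{x. Iso x \<notin> range Far} = UNIV" by auto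
    ultimately show False using not_small_UNIV by metis
  qed
  then have "\<not> closedin space A"
    by (simp add: closedin_def A_def Compl_eq_Diff_UNIV[symmetric])
  then obtain B x where B: "B \<subseteq> A" "x \<notin> A" "space closure_of B - B = {x}"
    using W unfolding weakly_Whyburn_space_def almost_closed_converging_to_def by auto
  have noFar: "B \<inter> range Far = {}" using B(1) by (auto simp: A_def)
  have limit_unique: "Far s = x" if "\<not> small s {w. Iso w \<in> B}" for s
    using Far_in_closure[OF that] noFar B(3) by blast
  obtain r where r: "x = Far r" using B(2) by (auto simp: A_def)
  then have "Far r \<in> space closure_of B" using B(3) by blast
  then obtain s where s: "\<not> small s {w. Iso w \<in> B}"
    using not_small_if_Far_in_closure noFar by blast
  \<comment> \<open>Contraposition with \<open>c = s\<close> yields a child beyond \<open>s\<close>,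
    so \<open>Far s\<close> and \<open>Far t\<close> are two distinct new limit points.\<close>
  then obtain t where "s < t" "\<not> small t {w. Iso w \<in> B}"
    using small_if_small_children by blast
  then show False using limit_unique s by (metis less_irrefl point.inject(3))
qed

end

section \<open>The first uncountable ordinal as a type\<close>

typedef omega1 = "Field (cardSuc natLeq)"
proof -
  have "Field (cardSuc natLeq) \<noteq> {}"
    using Cinfinite_cardSuc[OF natLeq_Cinfinite]
    by (metis cinfinite_def finite.emptyI)
  then show ?thesis by blast
qed

instantiation omega1 :: wellorder
begin

definition less_eq_omega1 :: "omega1 \<Rightarrow> omega1 \<Rightarrow> bool" where
  "x \<le> y \<longleftrightarrow> (Rep_omega1 x, Rep_omega1 y) \<in> cardSuc natLeq"

definition less_omega1 :: "omega1 \<Rightarrow> omega1 \<Rightarrow> bool" where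
  "(x :: omega1) < y \<longleftrightarrow> x \<le> y \<and> \<not> y \<le> x"

instance
proof
  have wo: "Well_order (cardSuc natLeq)"
    by (rule cardSuc_Well_order[OF natLeq_Card_order])
  fix x y z :: omega1
  show "x < y \<longleftrightarrow> x \<le> y \<and> \<not> y \<le> x" by (rule less_omega1_def)
  show "x \<le> x"
    using wo Rep_omega1[of x] unfolding less_eq_omega1_def
    by (auto simp: order_on_defs refl_on_def)
  show "x \<le> y \<Longrightarrow> y \<le> z \<Longrightarrow> x \<le> z"
    using wo unfolding less_eq_omega1_def by (auto simp: order_on_defs dest: transD)
  show "x \<le> y \<Longrightarrow> y \<le> x \<Longrightarrow> x = y"
    using wo unfolding less_eq_omega1_def
    by (auto simp: order_on_defs dest: antisymD intro: Rep_omega1_inject[THEN iffD1])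
  show "x \<le> y \<or> y \<le> x"
    using wo Rep_omega1[of x] Rep_omega1[of y] unfolding less_eq_omega1_def order_on_defs
    by (metis refl_onD total_on_def)
next
  fix P :: "omega1 \<Rightarrow> bool" and a :: omega1
  assume step: "\<And>x. (\<And>y. y < x \<Longrightarrow> P y) \<Longrightarrow> P x"
  have wo: "Well_order (cardSuc natLeq)"
    by (rule cardSuc_Well_order[OF natLeq_Card_order])
  have "{(x, y). x < y} \<subseteq> inv_image (cardSuc natLeq - Id) Rep_omega1"
    by (auto simp: less_omega1_def less_eq_omega1_def)
  moreover have "wf (inv_image (cardSuc natLeq - Id) Rep_omega1)"
    using wo by (simp add: well_order_on_def wf_inv_image)
  ultimately have "wf {(x, y :: omega1). x < y}" by (rule wf_subset[rotated])
  then show "P a" by (induction a rule: wf_induct_rule) (auto intro: step)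
qed

end

lemma card_omega1: "|UNIV :: omega1 set| =o cardSuc natLeq"
proof -
  have "bij_betw Rep_omega1 UNIV (Field (cardSuc natLeq))"
    by (metis bij_betw_def inj_onI Rep_omega1_inject type_definition.Rep_range type_definition_omega1)
  then have "|UNIV :: omega1 set| =o |Field (cardSuc natLeq)|"
    using card_of_ordIso by blast
  then show ?thesis
    using card_of_Field_ordIso[OF cardSuc_Card_order[OF natLeq_Card_order]] ordIso_transitive by blast
qed

text \<open>Proper initial segments of a cardinal have smaller cardinality, and below the successor
  of \<open>natLeq\<close> this means at most \<open>natLeq\<close>.\<close>

lemma countable_atMost_omega1: "countable {..w :: omega1}"
proof -
  let ?r = "cardSuc natLeq"
  have "|underS ?r (Rep_omega1 w)| <o ?r"
    using card_of_underS[OF cardSuc_Card_order[OF natLeq_Card_order]] Rep_omega1 by blast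
  then have "|underS ?r (Rep_omega1 w)| \<le>o natLeq"
    using cardSuc_ordLeq_ordLess[OF natLeq_Card_order card_of_Card_order] by blast
  then have "countable (underS ?r (Rep_omega1 w))"
    by (simp add: countable_card_le_natLeq)
  moreover have "Rep_omega1 ` {..<w} \<subseteq> underS ?r (Rep_omega1 w)"
    by (auto simp: underS_def less_le less_eq_omega1_def Rep_omega1_inject)
  ultimately have "countable (Rep_omega1 ` {..<w})" by (rule countable_subset[rotated])
  then have "countable {..<w}"
    by (rule countable_image_inj_on) (simp add: inj_on_def Rep_omega1_inject)
  moreover have "{..w} = insert w {..<w}" by auto
  ultimately show ?thesis by simp
qed

lemma infinite_omega1: "infinite (UNIV :: omega1 set)"
  and uncountable_omega1: "uncountable (UNIV :: omega1 set)"
proof -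
  show "uncountable (UNIV :: omega1 set)"
  proof
    assume "countable (UNIV :: omega1 set)"
    then have "|UNIV :: omega1 set| \<le>o natLeq" by (simp add: countable_card_le_natLeq)
    then have "cardSuc natLeq \<le>o natLeq"
      using card_omega1 ordIso_ordLeq_trans ordIso_symmetric by blast
    then show False
      using cardSuc_greater[OF natLeq_Card_order] not_ordLess_ordLeq by blast
  qed
  then show "infinite (UNIV :: omega1 set)" using countable_finite by blast
qed

text \<open>Let \<open>parent\<close> be the first coordinate of a bijection onto the square: its
  fibres are uncountable, hence unbounded.\<close>

lemma ex_omega1_tree: "\<exists>parent :: omega1 \<Rightarrow> omega1. omega1_tree parent"
proof -
  have "|UNIV :: omega1 set| =o |(UNIV :: omega1 set) \<times> (UNIV :: omega1 set)|"
    using card_of_Times_same_infinite[OF infinite_omega1] ordIso_symmetric by blast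
  then obtain \<pi> :: "omega1 \<Rightarrow> omega1 \<times> omega1" where \<pi>: "bij \<pi>"
    using card_of_ordIso by (metis UNIV_Times_UNIV)
  have "\<exists>x>b. (fst \<circ> \<pi>) x = s" for b s :: omega1
  proof (rule ccontr)
    assume "\<not> ?thesis"
    then have none: "fst (\<pi> x) \<noteq> s" if "b < x" for x using that by auto
    \<comment> \<open>A bounded fibre would embed the uncountable column over \<open>s\<close> into
      the countable set \<open>{..b}\<close>.\<close>
    have "inv \<pi> (s, t) \<le> b" for t
    proof (rule ccontr)
      assume "\<not> inv \<pi> (s, t) \<le> b"
      then have "fst (\<pi> (inv \<pi> (s, t))) \<noteq> s" by (intro none) simp
      then show False using \<pi> by (simp add: bij_is_surj surj_f_inv_f)
    qed
    then have "inv \<pi> ` ({s} \<times> UNIV) \<subseteq> {..b}" by auto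
    then have "countable (inv \<pi> ` ({s} \<times> UNIV))"
      using countable_atMost_omega1 countable_subset by blast
    then have "countable ({s} \<times> (UNIV :: omega1 set))"
      by (rule countable_image_inj_on) (metis \<pi> bij_imp_bij_inv bij_is_inj inj_on_subset subset_UNIV)
    then have "countable (snd ` ({s} \<times> (UNIV :: omega1 set)))" by (rule countable_image)
    then show False using uncountable_omega1 by simp
  qed
  then have "omega1_tree (fst \<circ> \<pi>)"
    by unfold_locales (auto simp: countable_atMost_omega1 uncountable_omega1)
  then show ?thesis by blast
qed

lemma card_point_omega1: "|UNIV :: omega1 point set| =o cardSuc natLeq"
proof -
  have U: "(UNIV :: omega1 point set) = range Iso \<union> (range Mid \<union> range Far)"
    by (metis (no_types, lifting) UNIV_eq_I UnCI point.exhaust rangeI)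
  have "|UNIV :: omega1 point set| \<le>o |UNIV :: omega1 set|"
    unfolding U
    by (intro card_of_Un_ordLeq_infinite_Field card_of_image card_of_Card_order)
      (simp_all add: Field_card_of infinite_omega1)
  moreover have "|UNIV :: omega1 set| \<le>o |UNIV :: omega1 point set|"
    using card_of_ordLeq[of "UNIV :: omega1 set" "UNIV :: omega1 point set"]
    by (meson injI point.inject(1) subset_UNIV)
  ultimately show ?thesis
    using card_omega1 ordIso_iff_ordLeq ordIso_transitive by blast
qed

theorem theorem2p3:
  shows "\<exists>X :: nat set topology.
           countably_compact_space X \<and> Hausdorff_space X \<and>
           |topspace X| =o cardSuc natLeq \<and> \<not> weakly_Whyburn_space X"
proof -
  obtain parent :: "omega1 \<Rightarrow> omega1" where "omega1_tree parent"
    using ex_omega1_tree by blast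
  then interpret omega1_tree parent .
  have card: "|topspace space| =o cardSuc natLeq"
    using card_point_omega1 by simp
  \<comment> \<open>The points so far have type \<open>omega1 point\<close>; the cardinality
    provides a homeomorphic copy on \<open>nat set\<close>, and all required properties are
    invariant.\<close>
  then obtain X :: "nat set topology" and f where f: "homeomorphic_map space X f"
    using aleph1_space_homeomorphic_nat_set_topology homeomorphic_space by metis
  have "countably_compact_space X"
    using f countably_compact_space countably_compact_space_continuous_map_image
    by (metis homeomorphic_eq_everything_map)
  moreover have "Hausdorff_space X"
    using f Hausdorff_space homeomorphic_Hausdorff_space homeomorphic_map_imp_homeomorphic_space by blast
  moreover have "\<not> weakly_Whyburn_space X"
    using weakly_Whyburn_space_homeomorphic_map[OF f] not_weakly_Whyburn_space by blast
  moreover have "|topspace X| =o cardSuc natLeq"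
  proof -
    have "bij_betw f (topspace space) (topspace X)"
      using f by (auto simp: homeomorphic_eq_everything_map bij_betw_def)
    then have "|topspace space| =o |topspace X|" using card_of_ordIso by blast
    then show ?thesis using card ordIso_symmetric ordIso_transitive by blast
  qed
  ultimately show ?thesis by blast
qed

end
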